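(* Let $r\ge 4$ be a positive integer. Then there exists a finite simple graph $G_r$ such that $h(G_r)=r+1$, $ha(G_r)=2r-1$, and $h(\epsilon(G_r))\in\{r+1,2r-1\}$ whenever $\epsilon$ is a harmonious homomorphism of the graph $G_r$.
   Context: Graphs are finite and simple; distance between vertices in different components is infinite. A harmonious $k$-coloring of a graph $G$ is a proper vertex coloring with $k$ colors such that every (unordered) pair of colors appears on at most one edge. The harmonious chromatic number $h(G)$ is the minimum $k$ such that $G$ has a harmonious $k$-coloring. An elementary harmonious homomorphism of a graph $G$ identifies two vertices $u,v$ with $d_G(u,v)\ge 3$: it maps both $u$ and $v$ to $u$ and fixes all other vertices; for a homomorphism $\varsigma$ defined on $G$, the image $\varsigma(G)$ has vertex set $\varsigma(V(G))$ and edge set $\{\varsigma(x)\varsigma(y):xy\in E(G)\}$. A harmonious homomorphism of $G$ is a composition of elementary harmonious homomorphisms, each one applied to the image graph of the previous ones (with distances measured in that image graph), leading from $G$ to a graph $H$ of diameter two; $H$ is then called a harmonious homomorphic image of $G$. The harmonious achromatic number $ha(G)$ is the largest order of a graph of diameter two that is a harmonious homomorphic image of $G$. *)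

theory Defs
  imports "Graph_Theory.Pair_Digraph" "Graph_Theory.Shortest_Path"
begin

(* Finite simple graphs are represented by the locale pair_graph: a finite vertex set together
   with a symmetric, irreflexive arc relation, so that the edge xy is the pair of arcs (x, y)
   and (y, x). *)

(* \<mu> is the infimum of the costs of all walks; with unit weights this is the usual distance,
   with value \<infinity> if there is no walk. *)
definition graph_dist :: "'a pair_pre_digraph \<Rightarrow> 'a \<Rightarrow> 'a \<Rightarrow> ereal" where
  "graph_dist G u v = wf_digraph.\<mu> (with_proj G) (\<lambda>_. 1) u v"

definition diameter :: "'a pair_pre_digraph \<Rightarrow> ereal" where
  "diameter G = (SUP u \<in> pverts G. SUP v \<in> pverts G. graph_dist G u v)"

(* Two arcs are compared as undirected edges, since (x, y) and (y, x) always carry the same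
   pair of colours. *)
definition harmonious_coloring :: "'a pair_pre_digraph \<Rightarrow> nat \<Rightarrow> ('a \<Rightarrow> nat) \<Rightarrow> bool" where
  "harmonious_coloring G k c \<longleftrightarrow>
     c ` pverts G \<subseteq> {..<k} \<and>
     (\<forall>(x, y) \<in> parcs G. c x \<noteq> c y) \<and>
     (\<forall>(x, y) \<in> parcs G. \<forall>(x', y') \<in> parcs G.
        {c x, c y} = {c x', c y'} \<longrightarrow> {x, y} = {x', y'})"

definition harmonious_chromatic_number :: "'a pair_pre_digraph \<Rightarrow> nat" where
  "harmonious_chromatic_number G = (LEAST k. \<exists>c. harmonious_coloring G k c)"

definition image_graph :: "('a \<Rightarrow> 'a) \<Rightarrow> 'a pair_pre_digraph \<Rightarrow> 'a pair_pre_digraph" where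
  "image_graph f G = \<lparr>pverts = f ` pverts G, parcs = map_prod f f ` parcs G\<rparr>"

definition elementary_harmonious_hom :: "'a pair_pre_digraph \<Rightarrow> ('a \<Rightarrow> 'a) \<Rightarrow> bool" where
  "elementary_harmonious_hom G f \<longleftrightarrow>
     (\<exists>u \<in> pverts G. \<exists>v \<in> pverts G. graph_dist G u v \<ge> 3 \<and> f = (\<lambda>x. if x = v then u else x))"

(* The empty composition is allowed, so a graph of diameter two is an image of itself. *)
inductive elementary_composition :: "'a pair_pre_digraph \<Rightarrow> ('a \<Rightarrow> 'a) \<Rightarrow> bool"
  for G :: "'a pair_pre_digraph" where
  empty: "elementary_composition G (\<lambda>x. x)"
| step: "elementary_composition G f \<Longrightarrow> elementary_harmonious_hom (image_graph f G) g
    \<Longrightarrow> elementary_composition G (g \<circ> f)"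

definition harmonious_hom :: "'a pair_pre_digraph \<Rightarrow> ('a \<Rightarrow> 'a) \<Rightarrow> bool" where
  "harmonious_hom G f \<longleftrightarrow> elementary_composition G f \<and> diameter (image_graph f G) = 2"

definition harmonious_image :: "'a pair_pre_digraph \<Rightarrow> 'a pair_pre_digraph \<Rightarrow> bool" where
  "harmonious_image G H \<longleftrightarrow> (\<exists>f. harmonious_hom G f \<and> H = image_graph f G)"

(* On nat, Sup is Max for nonempty sets and 0 for the empty set. The orders are bounded by that
   of G, so this is a maximum for every finite G that has a harmonious homomorphic image. *)
definition harmonious_achromatic_number :: "'a pair_pre_digraph \<Rightarrow> nat" where
  "harmonious_achromatic_number G = Sup {card (pverts H) | H. harmonious_image G H}"

end

theory Submission
  imports Defs
begin

text \<open>
  The graph is the disjoint union of a star with \<open>r\<close> leaves and a complete graph on \<open>r - 1\<close>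
  vertices. A vertex identification at distance at least three keeps the endpoints of an edge apart
  and never lets two edges collapse to one, so every composition \<open>f\<close> of such
  identifications is a harmonious map, that is, a harmonious colouring whose colours are vertices
  (\<open>elementary_composition_harmonious_map\<close>). A harmonious map separates vertices at
  distance at most two. This has two consequences. First, a graph of diameter two must give
  different colours to all its vertices, so its harmonious chromatic number is its order
  (\<open>harmonious_chromatic_number_eq_order\<close>). Secondly, \<open>f\<close> is injective on the star
  and on the clique, so it only merges leaves or the centre with clique vertices, in pairs.

  If \<open>f\<close> merges the centre with a clique vertex, a second merged pair would put an edge of the
  star onto an edge of the clique. So this is the only merged pair and the order drops from
  \<open>2 * r\<close> to \<open>2 * r - 1\<close>. If it does not, suppose that some clique vertex \<open>z\<close> stays unmerged.
  There are more leaves than clique vertices, so some leaf \<open>l\<close> stays unmerged too. The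
  neighbours of \<open>f z\<close> all come from the clique, while the only neighbour of \<open>f l\<close> is the image of
  the centre, which does not, so \<open>f z\<close> and \<open>f l\<close> are at distance at least three, which diameter two forbids. Hence the whole
  clique is merged into the leaves and the order is that of the star, \<open>r + 1\<close>
  (\<open>star_clique_image_order\<close>).

  The larger order is attained by merging the centre with a single clique vertex
  (\<open>star_clique_merge_centre\<close>). The graph itself has a harmonious colouring with \<open>r + 1\<close>
  colours, obtained by placing the clique onto leaves, and the star forces that many
  (\<open>harmonious_chromatic_number_star_clique\<close>).
\<close>

section \<open>Distance at most two\<close>

text \<open>
  Only the threshold between distances two and three matters: distance at least three is what an
  elementary identification demands, and distance at most two is what diameter two provides. Phrasing
  it through arcs instead of an infimum over walks lets the rest of the argument be purely
  combinatorial.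
\<close>

definition within_two :: "'a pair_pre_digraph \<Rightarrow> 'a \<Rightarrow> 'a \<Rightarrow> bool" where
  "within_two G u v \<longleftrightarrow>
     u = v \<or> (u, v) \<in> parcs G \<or> (\<exists>w. (u, w) \<in> parcs G \<and> (w, v) \<in> parcs G)"

lemma graph_dist_eq_INF:
  assumes "pair_wf_digraph G"
  shows "graph_dist G u v
    = (INF p \<in> {p. pre_digraph.awalk (with_proj G) u p v}. ereal (real (length p)))"
proof -
  interpret pair_wf_digraph G by fact
  show ?thesis
    by (simp add: graph_dist_def \<mu>_def awalk_cost_def sum_list_triv)
qed

lemma graph_dist_le_walk_length:
  assumes "pair_wf_digraph G" and "pre_digraph.awalk (with_proj G) u p v"
  shows "graph_dist G u v \<le> ereal (real (length p))"
  unfolding graph_dist_eq_INF[OF assms(1)] using assms(2) by (intro INF_lower) simp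

text \<open>Only a strict bound on an infimum is witnessed by a single walk. This is why the facts below
  that extract a walk assume a distance \<open>< 3\<close> or \<open>< 2\<close> instead of \<open>\<le> 2\<close> or \<open>\<le> 1\<close>.\<close>

lemma graph_dist_less_imp_walk:
  assumes "pair_wf_digraph G" and "graph_dist G u v < ereal (real n)"
  obtains p where "pre_digraph.awalk (with_proj G) u p v" and "length p < n"
  using assms by (auto simp: graph_dist_eq_INF INF_less_iff)

lemma graph_dist_le_2_if_within_two:
  assumes "pair_wf_digraph G" and "u \<in> pverts G" and "within_two G u v"
  shows "graph_dist G u v \<le> 2"
proof -
  interpret pair_wf_digraph G by fact
  obtain p where "awalk u p v" and len: "length p \<le> 2"
  proof -
    consider "u = v" | "(u, v) \<in> parcs G" | w where "(u, w) \<in> parcs G" "(w, v) \<in> parcs G"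
      using assms(3) by (auto simp: within_two_def)
    then show thesis
    proof cases
      case 1
      then show thesis using assms(2) that[of "[]"] by (simp add: awalk_Nil_iff)
    next
      case 2
      then show thesis using that[of "[(u, v)]"] in_arcsD2
        by (simp add: awalk_Cons_iff awalk_Nil_iff)
    next
      case (3 w)
      then show thesis using that[of "[(u, w), (w, v)]"] in_arcsD2
        by (simp add: awalk_Cons_iff awalk_Nil_iff)
    qed
  qed
  then have "graph_dist G u v \<le> ereal (real (length p))"
    by (intro graph_dist_le_walk_length[OF assms(1)])
  also have "\<dots> \<le> 2" using len by simp
  finally show ?thesis .
qed

lemma within_two_if_graph_dist_less_3:
  assumes "pair_wf_digraph G" and "graph_dist G u v < 3"
  shows "within_two G u v"
proof -
  interpret pair_wf_digraph G by fact
  obtain p where walk: "awalk u p v" and "length p < 3"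
    using graph_dist_less_imp_walk[OF assms(1), of u v 3] assms(2) by auto
  then consider "p = []" | a where "p = [a]" | a b where "p = [a, b]"
    by (cases p rule: list.exhaust; cases "tl p"; cases "tl (tl p)") auto
  then show ?thesis
    using walk by cases (auto simp: within_two_def awalk_Cons_iff awalk_Nil_iff)
qed

lemma diameter_2_imp_within_two:
  assumes "pair_wf_digraph G" and "diameter G = 2" and "u \<in> pverts G" and "v \<in> pverts G"
  shows "within_two G u v"
proof -
  have "graph_dist G u v \<le> diameter G"
    unfolding diameter_def using assms(3,4) by (intro SUP_upper2[of u] SUP_upper2[of v]) auto
  also have "diameter G < 3"
    using assms(2) by simp
  finally show ?thesis
    by (rule within_two_if_graph_dist_less_3[OF assms(1)])
qed

lemma diameter_eq_2I:
  assumes wf: "pair_wf_digraph G"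
    and within: "\<And>u v. u \<in> pverts G \<Longrightarrow> v \<in> pverts G \<Longrightarrow> within_two G u v"
    and xy: "x \<in> pverts G" "y \<in> pverts G" "x \<noteq> y" "(x, y) \<notin> parcs G"
  shows "diameter G = 2"
proof (rule antisym)
  show "diameter G \<le> 2"
    unfolding diameter_def
    by (intro SUP_least graph_dist_le_2_if_within_two[OF wf] within)
  interpret pair_wf_digraph G by (rule wf)
  have "\<not> graph_dist G x y < 2"
  proof
    assume "graph_dist G x y < 2"
    then obtain p where walk: "awalk x p y" and "length p < 2"
      using graph_dist_less_imp_walk[OF wf, of x y 2] by auto
    then consider "p = []" | a where "p = [a]"
      by (cases p rule: list.exhaust; cases "tl p") auto
    then show False
      using walk xy by cases (auto simp: awalk_Cons_iff awalk_Nil_iff)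
  qed
  then have "2 \<le> graph_dist G x y" by simp
  also have "\<dots> \<le> diameter G"
    unfolding diameter_def using xy by (intro SUP_upper2[of x] SUP_upper2[of y]) auto
  finally show "2 \<le> diameter G" .
qed

section \<open>Harmonious maps\<close>

text \<open>Colours of an arbitrary type allow vertex identifications and colourings by natural numbers
  to be treated as instances of one notion.\<close>

definition harmonious_map :: "'a pair_pre_digraph \<Rightarrow> ('a \<Rightarrow> 'b) \<Rightarrow> bool" where
  "harmonious_map G f \<longleftrightarrow>
     (\<forall>x y. (x, y) \<in> parcs G \<longrightarrow> f x \<noteq> f y) \<and>
     (\<forall>x y. (x, y) \<in> parcs G \<longrightarrow> (\<forall>x' y'. (x', y') \<in> parcs G \<longrightarrow>
        {f x, f y} = {f x', f y'} \<longrightarrow> {x, y} = {x', y'}))"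

lemma harmonious_coloring_iff:
  "harmonious_coloring G k c \<longleftrightarrow> c ` pverts G \<subseteq> {..<k} \<and> harmonious_map G c"
  by (simp only: harmonious_coloring_def harmonious_map_def Ball_def split_paired_All case_prod_conv)

lemma harmonious_mapD:
  assumes "harmonious_map G f"
  shows "(x, y) \<in> parcs G \<Longrightarrow> f x \<noteq> f y"
    and "(x, y) \<in> parcs G \<Longrightarrow> (x', y') \<in> parcs G \<Longrightarrow>
      {f x, f y} = {f x', f y'} \<Longrightarrow> {x, y} = {x', y'}"
  using assms unfolding harmonious_map_def by blast+

text \<open>Two vertices with a common neighbour \<open>w\<close> and the same colour would give their edges
  to \<open>w\<close> the same pair of colours.\<close>

lemma harmonious_map_inj_within_two:
  assumes "harmonious_map G f" and "within_two G u v" and "f u = f v"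
  shows "u = v"
proof -
  consider "u = v" | "(u, v) \<in> parcs G" | w where "(u, w) \<in> parcs G" "(w, v) \<in> parcs G"
    using assms(2) by (auto simp: within_two_def)
  then show ?thesis
  proof cases
    case (3 w)
    then have "{u, w} = {w, v}"
      by (intro harmonious_mapD(2)[OF assms(1)]) (use assms(3) in auto)
    then show ?thesis by (auto simp: doubleton_eq_iff)
  qed (use assms harmonious_mapD(1)[OF assms(1)] in auto)
qed

lemma harmonious_map_inj_on:
  assumes "harmonious_map G f" and "\<And>u v. u \<in> S \<Longrightarrow> v \<in> S \<Longrightarrow> within_two G u v"
  shows "inj_on f S"
  by (intro inj_onI harmonious_map_inj_within_two[OF assms(1)] assms(2))

lemma harmonious_map_id:
  "(\<And>x. (x, x) \<notin> parcs G) \<Longrightarrow> harmonious_map G (\<lambda>x. x)"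
  by (auto simp: harmonious_map_def)

lemma in_parcs_image_graph:
  "(a, b) \<in> parcs (image_graph f G) \<longleftrightarrow> (\<exists>x y. (x, y) \<in> parcs G \<and> a = f x \<and> b = f y)"
  by (force simp: image_graph_def)

lemma pverts_image_graph: "pverts (image_graph f G) = f ` pverts G"
  by (simp add: image_graph_def)

lemma image_graph_id: "image_graph (\<lambda>x. x) G = G"
  by (cases G) (simp add: image_graph_def map_prod.identity[unfolded id_def])

lemma harmonious_map_comp:
  assumes "harmonious_map G f" and "harmonious_map (image_graph f G) g"
  shows "harmonious_map G (g \<circ> f)"
  unfolding harmonious_map_def
proof (intro conjI allI impI)
  fix x y assume "(x, y) \<in> parcs G"
  then have "(f x, f y) \<in> parcs (image_graph f G)" by (auto simp: in_parcs_image_graph)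
  then show "(g \<circ> f) x \<noteq> (g \<circ> f) y" using harmonious_mapD(1)[OF assms(2)] by simp
next
  fix x y x' y' assume *: "(x, y) \<in> parcs G" "(x', y') \<in> parcs G"
    and eq: "{(g \<circ> f) x, (g \<circ> f) y} = {(g \<circ> f) x', (g \<circ> f) y'}"
  then have "(f x, f y) \<in> parcs (image_graph f G)" "(f x', f y') \<in> parcs (image_graph f G)"
    by (auto simp: in_parcs_image_graph)
  then have "{f x, f y} = {f x', f y'}"
    by (rule harmonious_mapD(2)[OF assms(2)]) (use eq in simp)
  then show "{x, y} = {x', y'}"
    by (rule harmonious_mapD(2)[OF assms(1) *])
qed

lemma pair_sym_digraphI:
  assumes "\<And>x y. (x, y) \<in> parcs G \<Longrightarrow> x \<in> pverts G"
    and "\<And>x y. (x, y) \<in> parcs G \<Longrightarrow> (y, x) \<in> parcs G"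
  shows "pair_sym_digraph G"
proof unfold_locales
  show "fst e \<in> pverts G" "snd e \<in> pverts G" if "e \<in> parcs G" for e
    using that assms by (cases e, force)+
  show "symmetric G"
    using assms(2) by (simp add: symmetric_def sym_def)
qed

lemma pair_sym_digraph_symD:
  assumes "pair_sym_digraph G" and "(x, y) \<in> parcs G"
  shows "(y, x) \<in> parcs G"
  using pair_sym_digraph.pair_sym_arcs[OF assms(1)] assms(2)
  by (simp add: symmetric_def sym_def)

lemma pair_sym_digraph_image_graph:
  assumes "pair_sym_digraph G"
  shows "pair_sym_digraph (image_graph f G)"
proof -
  interpret pair_sym_digraph G by fact
  show ?thesis
  proof (rule pair_sym_digraphI)
    fix a b assume "(a, b) \<in> parcs (image_graph f G)"
    then obtain x y where xy: "(x, y) \<in> parcs G" "a = f x" "b = f y"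
      by (auto simp: in_parcs_image_graph)
    then show "a \<in> pverts (image_graph f G)"
      using in_arcsD1 by (auto simp: pverts_image_graph)
    show "(b, a) \<in> parcs (image_graph f G)"
      unfolding in_parcs_image_graph using pair_sym_digraph_symD[OF assms xy(1)] xy(2,3) by blast
  qed
qed

text \<open>
  The only distinct vertices with the same image are \<open>u\<close> and \<open>v\<close>. Two edges with the same image therefore
  either share an endpoint, and the other endpoints are \<open>u\<close> and \<open>v\<close>, which then have a common
  neighbour, or they lie inside \<open>{u, v}\<close>, and then \<open>u\<close> and \<open>v\<close> are adjacent.
\<close>

lemma harmonious_map_merge:
  assumes G: "pair_sym_digraph G" and loopfree: "\<And>x. (x, x) \<notin> parcs G"
    and far: "\<not> within_two G u v"
  shows "harmonious_map G (\<lambda>x. if x = v then u else x)"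
proof -
  let ?g = "\<lambda>x. if x = v then u else x"
  note sym = pair_sym_digraph_symD[OF G]
  have uv: "(u, v) \<notin> parcs G" "(v, u) \<notin> parcs G"
    and no_w: "\<not> ((u, w) \<in> parcs G \<and> (v, w) \<in> parcs G)" for w
    using far sym by (auto simp: within_two_def)
  have fibre: "a = b \<or> a = u \<and> b = v \<or> a = v \<and> b = u" if "?g a = ?g b" for a b
    using that by (auto split: if_splits)
  \<comment> \<open>Two edges with the same orientation of their images; the opposite orientation is reduced to
    this case by reversing one of them.\<close>
  have same: "x = x' \<and> y = y'"
    if "(x, y) \<in> parcs G" "(x', y') \<in> parcs G" "?g x = ?g x'" "?g y = ?g y'" for x y x' y'
    using fibre[OF that(3)] fibre[OF that(4)] that(1,2) loopfree uv no_w sym by blast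
  show ?thesis
    unfolding harmonious_map_def
  proof (intro conjI allI impI)
    show "?g x \<noteq> ?g y" if "(x, y) \<in> parcs G" for x y
      using fibre[of x y] that loopfree uv by blast
    fix x y x' y'
    assume arcs: "(x, y) \<in> parcs G" "(x', y') \<in> parcs G" and eq: "{?g x, ?g y} = {?g x', ?g y'}"
    from eq consider "?g x = ?g x'" "?g y = ?g y'" | "?g x = ?g y'" "?g y = ?g x'"
      by (auto simp only: doubleton_eq_iff)
    then show "{x, y} = {x', y'}"
    proof cases
      case 1
      with same arcs show ?thesis by blast
    next
      case 2
      with same[of x y y' x'] arcs sym show ?thesis by blast
    qed
  qed
qed

text \<open>Harmonious maps compose, and the image of a loop-free graph under one of them is again
  loop-free, which makes the next identification applicable.\<close>

lemma elementary_composition_harmonious_map: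
  assumes "elementary_composition G f"
    and G: "pair_sym_digraph G" and loopfree: "\<And>x. (x, x) \<notin> parcs G"
  shows "harmonious_map G f"
  using assms(1)
proof induction
  case empty
  show ?case using loopfree by (rule harmonious_map_id)
next
  case (step f g)
  let ?H = "image_graph f G"
  have H: "pair_sym_digraph ?H" using G by (rule pair_sym_digraph_image_graph)
  then interpret H: pair_sym_digraph ?H .
  obtain u v where uv: "u \<in> pverts ?H" "graph_dist ?H u v \<ge> 3" "g = (\<lambda>x. if x = v then u else x)"
    using step.hyps(2) by (auto simp: elementary_harmonious_hom_def)
  have "\<not> within_two ?H u v"
  proof
    assume "within_two ?H u v"
    with uv(1) have "graph_dist ?H u v \<le> 2"
      by (rule graph_dist_le_2_if_within_two[OF H.pair_wf_digraph_axioms])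
    with uv(2) have "(3::ereal) \<le> 2" by (rule order_trans)
    then show False by simp
  qed
  moreover have "(a, a) \<notin> parcs ?H" for a
    using harmonious_mapD(1)[OF step.IH] by (auto simp: in_parcs_image_graph)
  ultimately have "harmonious_map ?H g"
    unfolding uv(3) by (intro harmonious_map_merge[OF H])
  with step.IH show ?case
    by (rule harmonious_map_comp)
qed

text \<open>A set of vertices that are pairwise within distance two plays the role that a clique plays
  for ordinary colourings: its colours are all different.\<close>

lemma harmonious_chromatic_number_eq:
  assumes col: "harmonious_coloring G (card S) c" and S: "S \<subseteq> pverts G"
    and within: "\<And>u v. u \<in> S \<Longrightarrow> v \<in> S \<Longrightarrow> within_two G u v"
  shows "harmonious_chromatic_number G = card S"
  unfolding harmonious_chromatic_number_def
proof (rule Least_equality)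
  show "\<exists>c. harmonious_coloring G (card S) c" using col by blast
next
  fix k assume "\<exists>c. harmonious_coloring G k c"
  then obtain d where d: "d ` pverts G \<subseteq> {..<k}" "harmonious_map G d"
    by (auto simp: harmonious_coloring_iff)
  have "inj_on d S" by (intro harmonious_map_inj_on[OF d(2)] within)
  then have "card S = card (d ` S)" by (simp add: card_image)
  also have "\<dots> \<le> card {..<k}" using d(1) S by (intro card_mono) auto
  finally show "card S \<le> k" by simp
qed

text \<open>No two vertices can share a colour, and an injective colouring is harmonious because a
  pair of colours then determines the pair of vertices.\<close>

lemma harmonious_chromatic_number_eq_order:
  assumes "finite (pverts G)" and wf: "pair_wf_digraph G" and loopfree: "\<And>x. (x, x) \<notin> parcs G"
    and "\<And>u v. u \<in> pverts G \<Longrightarrow> v \<in> pverts G \<Longrightarrow> within_two G u v"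
  shows "harmonious_chromatic_number G = card (pverts G)"
proof -
  interpret pair_wf_digraph G by (rule wf)
  obtain c where c: "bij_betw c (pverts G) {0..<card (pverts G)}"
    using ex_bij_betw_finite_nat[OF assms(1)] by blast
  then have inj: "c x = c y \<longleftrightarrow> x = y" if "x \<in> pverts G" "y \<in> pverts G" for x y
    using that by (auto simp: bij_betw_def dest: inj_onD)
  have "harmonious_map G c"
    unfolding harmonious_map_def
  proof (intro conjI allI impI)
    show "c x \<noteq> c y" if "(x, y) \<in> parcs G" for x y
      using that inj in_arcsD1 in_arcsD2 loopfree by metis
    show "{x, y} = {x', y'}"
      if "(x, y) \<in> parcs G" "(x', y') \<in> parcs G" "{c x, c y} = {c x', c y'}" for x y x' y'
    proof -
      have "x \<in> pverts G" "y \<in> pverts G" "x' \<in> pverts G" "y' \<in> pverts G"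
        using that in_arcsD1 in_arcsD2 by auto
      then show ?thesis using that(3) by (simp add: doubleton_eq_iff inj)
    qed
  qed
  moreover have "c ` pverts G \<subseteq> {..<card (pverts G)}"
    using c by (auto simp: bij_betw_def)
  ultimately have "harmonious_coloring G (card (pverts G)) c"
    by (simp add: harmonious_coloring_iff)
  then show ?thesis
    using assms(4) by (intro harmonious_chromatic_number_eq) auto
qed

section \<open>A star and a complete graph\<close>

text \<open>The star has centre \<open>0\<close> and leaves \<open>1, \<dots>, r\<close>; the clique occupies
  \<open>r + 1, \<dots>, 2 * r - 1\<close>. Having fewer clique vertices than leaves is what
  \<open>star_clique_image_order\<close> relies on.\<close>

definition star_clique :: "nat \<Rightarrow> nat pair_pre_digraph" where
  "star_clique r = \<lparr>pverts = {..<2 * r},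
     parcs = {(0, l) | l. l \<in> {1..r}} \<union> {(l, 0) | l. l \<in> {1..r}}
       \<union> {(a, b). a \<in> {r<..<2 * r} \<and> b \<in> {r<..<2 * r} \<and> a \<noteq> b}\<rparr>"

lemma pverts_star_clique: "pverts (star_clique r) = {..<2 * r}"
  by (simp add: star_clique_def)

lemma in_parcs_star_clique:
  "(a, b) \<in> parcs (star_clique r) \<longleftrightarrow>
     a = 0 \<and> b \<in> {1..r} \<or> a \<in> {1..r} \<and> b = 0 \<or>
     a \<in> {r<..<2 * r} \<and> b \<in> {r<..<2 * r} \<and> a \<noteq> b"
  by (auto simp: star_clique_def)

lemma within_two_star_clique:
  "u \<le> r \<Longrightarrow> v \<le> r \<Longrightarrow> within_two (star_clique r) u v"
  "r < u \<Longrightarrow> u < 2 * r \<Longrightarrow> r < v \<Longrightarrow> v < 2 * r \<Longrightarrow> within_two (star_clique r) u v"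
proof -
  assume "u \<le> r" "v \<le> r"
  then consider "u = v" | "u = 0" "v \<in> {1..r}" | "v = 0" "u \<in> {1..r}"
    | "u \<in> {1..r}" "v \<in> {1..r}"
    by force
  then show "within_two (star_clique r) u v"
    by cases (auto simp: within_two_def in_parcs_star_clique)
qed (auto simp: within_two_def in_parcs_star_clique)

lemma pair_graph_star_clique:
  assumes "r \<ge> 2"
  shows "pair_graph (star_clique r)"
proof -
  have "parcs (star_clique r) \<subseteq> {..<2 * r} \<times> {..<2 * r}"
    using assms by (auto simp: in_parcs_star_clique)
  then have "finite (parcs (star_clique r))"
    by (rule finite_subset) auto
  with assms show ?thesis
    by unfold_locales
      (auto simp: pverts_star_clique in_parcs_star_clique symmetric_def intro!: symI)
qed

text \<open>
  If the centre is merged with a clique vertex, injectivity on edges excludes any further merging.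
  Otherwise the bound on distances in the image forces every clique vertex to be merged with a
  leaf.
\<close>

lemma star_clique_image_order:
  assumes r: "r \<ge> 2" and f: "harmonious_map (star_clique r) f"
    and within: "\<And>x y. x < 2 * r \<Longrightarrow> y < 2 * r \<Longrightarrow>
      within_two (image_graph f (star_clique r)) (f x) (f y)"
  shows "card (f ` {..<2 * r}) \<in> {r + 1, 2 * r - 1}"
proof -
  define S K where "S = {..r}" and "K = {r<..<2 * r}"
  note arcs = in_parcs_star_clique
  have V: "{..<2 * r} = S \<union> K" using r by (auto simp: S_def K_def)
  have injS: "inj_on f S" and injK: "inj_on f K"
    by (rule harmonious_map_inj_on[OF f]; simp add: within_two_star_clique S_def K_def)+
  show ?thesis
  proof (cases "f 0 \<in> f ` K")
    case True
    then obtain k where k: "k \<in> K" "f k = f 0" by auto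
    have "f ` S \<inter> f ` K = {f 0}"
    proof (intro equalityI subsetI)
      fix a assume "a \<in> f ` S \<inter> f ` K"
      then obtain l k' where l: "l \<in> S" "a = f l" and k': "k' \<in> K" "a = f k'" by auto
      have "l = 0"
      proof (rule ccontr)
        assume "l \<noteq> 0"
        then have "f l \<noteq> f 0" using injS l(1) by (auto simp: inj_on_def S_def)
        then have "k' \<noteq> k" using k l k' by auto
        \<comment> \<open>The star edge from the centre to \<open>l\<close> would lie over the clique edge from \<open>k\<close> to \<open>k'\<close>.\<close>
        have "{0, l} = {k, k'}"
        proof (rule harmonious_mapD(2)[OF f])
          show "(0, l) \<in> parcs (star_clique r)"
            using \<open>l \<noteq> 0\<close> l(1) by (simp add: arcs S_def)
          show "(k, k') \<in> parcs (star_clique r)"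
            using k(1) k'(1) \<open>k' \<noteq> k\<close> by (simp add: arcs K_def)
          show "{f 0, f l} = {f k, f k'}"
            using k(2) l(2) k'(2) by simp
        qed
        then show False using k(1) k'(1) by (auto simp: K_def doubleton_eq_iff)
      qed
      then show "a \<in> {f 0}" using l by simp
    qed (use True in \<open>auto simp: S_def\<close>)
    then have "card (f ` S) + card (f ` K) = card (f ` {..<2 * r}) + 1"
      using card_Un_Int[of "f ` S" "f ` K"] by (simp add: V image_Un S_def K_def)
    moreover have "card (f ` S) = r + 1" "card (f ` K) = r - 1"
      using injS injK by (simp_all add: card_image S_def K_def)
    ultimately have "card (f ` {..<2 * r}) = 2 * r - 1" using r by linarith
    then show ?thesis by simp
  next
    case False
    have "f ` K \<subseteq> f ` S"
    proof (rule ccontr)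
      assume "\<not> f ` K \<subseteq> f ` S"
      then obtain z where z: "z \<in> K" "f z \<notin> f ` S" by auto
      \<comment> \<open>The \<open>r\<close> leaves cannot all be merged with the \<open>r - 1\<close> clique vertices.\<close>
      have "\<not> f ` {1..r} \<subseteq> f ` K"
      proof
        assume "f ` {1..r} \<subseteq> f ` K"
        then have "card (f ` {1..r}) \<le> card (f ` K)" by (intro card_mono) (auto simp: K_def)
        also have "\<dots> \<le> card K" by (intro card_image_le) (auto simp: K_def)
        also have "card (f ` {1..r}) = card {1..r}"
          using injS by (intro card_image) (auto simp: inj_on_def S_def)
        finally show False using r by (simp add: K_def)
      qed
      then obtain l where l: "l \<in> {1..r}" "f l \<notin> f ` K" by blast
      have from_K: "b \<in> f ` K" if zb: "(f z, b) \<in> parcs (image_graph f (star_clique r))" for b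
      proof -
        obtain x y where "(x, y) \<in> parcs (star_clique r)" "f z = f x" "b = f y"
          using zb by (auto simp: in_parcs_image_graph)
        moreover have "x \<notin> S" using z(2) \<open>f z = f x\<close> by auto
        ultimately show ?thesis by (auto simp: arcs S_def K_def)
      qed
      have to_l: "a = f 0" if al: "(a, f l) \<in> parcs (image_graph f (star_clique r))" for a
      proof -
        obtain x y where xy: "(x, y) \<in> parcs (star_clique r)" "a = f x" "f l = f y"
          using al by (auto simp: in_parcs_image_graph)
        have "y \<notin> K" using l(2) xy(3) by auto
        then have "y \<in> S" using xy(1) by (auto simp: arcs S_def K_def)
        then have "y = l" using injS xy(3) l(1) by (auto simp: inj_on_def S_def)
        then show ?thesis using xy l \<open>y \<notin> K\<close> by (auto simp: arcs K_def)
      qed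
      have "within_two (image_graph f (star_clique r)) (f z) (f l)"
        using within z(1) l(1) r by (auto simp: K_def)
      then show False
        unfolding within_two_def using from_K to_l z(1) l(2) False by (metis imageI)
    qed
    then have "f ` {..<2 * r} = f ` S" by (auto simp: V)
    then show ?thesis using injS by (simp add: card_image S_def)
  qed
qed

lemma harmonious_chromatic_number_star_clique:
  assumes "r \<ge> 2"
  shows "harmonious_chromatic_number (star_clique r) = r + 1"
proof -
  \<comment> \<open>Clique vertex \<open>r + i\<close> gets the colour of leaf \<open>i\<close>. Edges of the star and of the clique are
    told apart by whether colour \<open>0\<close> occurs on them.\<close>
  define c where "c = (\<lambda>x::nat. if x \<le> r then x else x - r)"
  have c: "c x = (if x \<le> r then x else x - r)" for x by (simp add: c_def)
  define S K where "S = {..r}" and "K = {r<..<2 * r}"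
  have inj: "inj_on c S" "inj_on c K" by (auto simp: inj_on_def c S_def K_def)
  have zero: "c x = 0 \<longleftrightarrow> x = 0" for x by (simp add: c)
  have arc: "{x, y} \<subseteq> S \<and> 0 \<in> {x, y} \<or> {x, y} \<subseteq> K \<and> 0 \<notin> {x, y}"
    if "(x, y) \<in> parcs (star_clique r)" for x y
    using that by (auto simp: in_parcs_star_clique S_def K_def)
  have "harmonious_map (star_clique r) c"
    unfolding harmonious_map_def
  proof (intro conjI allI impI)
    show "c x \<noteq> c y" if "(x, y) \<in> parcs (star_clique r)" for x y
      using that by (auto simp: in_parcs_star_clique c)
    fix x y x' y'
    assume arcs: "(x, y) \<in> parcs (star_clique r)" "(x', y') \<in> parcs (star_clique r)"
      and "{c x, c y} = {c x', c y'}"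
    then have eq: "c ` {x, y} = c ` {x', y'}" by simp
    have "0 \<in> c ` A \<longleftrightarrow> 0 \<in> A" for A using zero by force
    with eq have "0 \<in> {x, y} \<longleftrightarrow> 0 \<in> {x', y'}" by metis
    with arc[OF arcs(1)] arc[OF arcs(2)] consider "{x, y} \<subseteq> S" "{x', y'} \<subseteq> S"
      | "{x, y} \<subseteq> K" "{x', y'} \<subseteq> K" by argo
    then show "{x, y} = {x', y'}"
      using eq inj_on_image_eq_iff[OF inj(1)] inj_on_image_eq_iff[OF inj(2)] by cases metis+
  qed
  moreover have "c ` {..<2 * r} \<subseteq> {..<r + 1}" using assms by (auto simp: c)
  ultimately have "harmonious_coloring (star_clique r) (card {..r}) c"
    by (simp add: harmonious_coloring_iff pverts_star_clique)
  then have "harmonious_chromatic_number (star_clique r) = card {..r}"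
    by (rule harmonious_chromatic_number_eq)
      (use assms in \<open>auto simp: pverts_star_clique within_two_star_clique\<close>)
  then show ?thesis by simp
qed

text \<open>After this single identification the centre is adjacent to every other vertex, so all
  distances are at most two, and the leaves \<open>1\<close> and \<open>2\<close> are still not adjacent.\<close>

lemma star_clique_merge_centre:
  assumes r: "r \<ge> 2"
  defines "f \<equiv> \<lambda>x. if x = r + 1 then 0 else x"
  shows "harmonious_hom (star_clique r) f"
    and "card (pverts (image_graph f (star_clique r))) = 2 * r - 1"
proof -
  let ?G = "star_clique r" and ?H = "image_graph f (star_clique r)"
  interpret pair_graph ?G using r by (rule pair_graph_star_clique)
  interpret H: pair_sym_digraph ?H
    by (rule pair_sym_digraph_image_graph) unfold_locales
  have verts: "pverts ?H = {..<2 * r} - {r + 1}"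
    using r by (auto simp: pverts_image_graph pverts_star_clique f_def)
  show "card (pverts ?H) = 2 * r - 1"
    using r unfolding verts by (subst card_Diff_singleton) auto
  have arc: "(f x, f y) \<in> parcs ?H" if "(x, y) \<in> parcs ?G" for x y
    using that by (auto simp: in_parcs_image_graph)
  have centre: "(0, x) \<in> parcs ?H" if "x \<in> pverts ?H" "x \<noteq> 0" for x
  proof -
    have x: "x < 2 * r" "x \<noteq> r + 1" using that(1) by (auto simp: verts)
    then have f: "f 0 = 0" "f (r + 1) = 0" "f x = x" by (simp_all add: f_def)
    have "(0, x) \<in> parcs ?G \<or> (r + 1, x) \<in> parcs ?G"
      using x that(2) by (auto simp: in_parcs_star_clique)
    then show ?thesis
      using arc[of 0 x] arc[of "r + 1" x] by (auto simp only: f)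
  qed
  have "diameter ?H = 2"
  proof (rule diameter_eq_2I[OF H.pair_wf_digraph_axioms])
    show "within_two ?H u v" if "u \<in> pverts ?H" "v \<in> pverts ?H" for u v
      using that centre pair_sym_digraph_symD[OF H.pair_sym_digraph_axioms]
      unfolding within_two_def by metis
    show "1 \<in> pverts ?H" "2 \<in> pverts ?H" "(1::nat) \<noteq> 2"
      using r unfolding verts by auto
    show "(1, 2) \<notin> parcs ?H"
      using r by (auto simp: in_parcs_image_graph in_parcs_star_clique f_def
          split: if_splits)
  qed
  moreover have "elementary_harmonious_hom ?G f"
  proof -
    have "\<not> within_two ?G 0 (r + 1)"
      by (auto simp: within_two_def in_parcs_star_clique)
    then have "graph_dist ?G 0 (r + 1) \<ge> 3"
      using within_two_if_graph_dist_less_3[OF pair_wf_digraph_axioms] by force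
    then show ?thesis
      using r unfolding elementary_harmonious_hom_def f_def
      by (intro bexI[of _ 0] bexI[of _ "r + 1"]) (auto simp: pverts_star_clique)
  qed
  then have "elementary_composition ?G (f \<circ> (\<lambda>x. x))"
    by (intro elementary_composition.intros) (simp add: image_graph_id)
  ultimately show "harmonious_hom ?G f"
    by (simp add: harmonious_hom_def comp_def)
qed

theorem theorem6:
  fixes r :: nat
  assumes "r \<ge> 4"
  shows "\<exists>G :: nat pair_pre_digraph. pair_graph G \<and>
    harmonious_chromatic_number G = r + 1 \<and>
    harmonious_achromatic_number G = 2 * r - 1 \<and>
    (\<forall>\<epsilon>. harmonious_hom G \<epsilon> \<longrightarrow>
       harmonious_chromatic_number (image_graph \<epsilon> G) \<in> {r + 1, 2 * r - 1})"
proof -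
  let ?G = "star_clique r"
  have r: "r \<ge> 2" using assms by simp
  then interpret pair_graph ?G by (rule pair_graph_star_clique)
  have image: "card (pverts (image_graph f ?G)) \<in> {r + 1, 2 * r - 1}"
    "harmonious_chromatic_number (image_graph f ?G) = card (pverts (image_graph f ?G))"
    if hom: "harmonious_hom ?G f" for f
  proof -
    interpret H: pair_sym_digraph "image_graph f ?G"
      by (rule pair_sym_digraph_image_graph) unfold_locales
    have f: "harmonious_map ?G f"
      using hom
      by (intro elementary_composition_harmonious_map pair_sym_digraph_axioms)
        (simp_all add: harmonious_hom_def in_parcs_star_clique)
    have within: "within_two (image_graph f ?G) u v"
      if "u \<in> f ` pverts ?G" "v \<in> f ` pverts ?G" for u v
      using hom that
      by (intro diameter_2_imp_within_two H.pair_wf_digraph_axioms)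
        (auto simp: harmonious_hom_def pverts_image_graph)
    show "card (pverts (image_graph f ?G)) \<in> {r + 1, 2 * r - 1}"
      using star_clique_image_order[OF r f] within
      by (simp add: pverts_image_graph pverts_star_clique)
    show "harmonious_chromatic_number (image_graph f ?G) = card (pverts (image_graph f ?G))"
      using within harmonious_mapD(1)[OF f]
      by (intro harmonious_chromatic_number_eq_order H.pair_wf_digraph_axioms)
        (auto simp: pverts_image_graph in_parcs_image_graph pverts_star_clique)
  qed
  have "harmonious_achromatic_number ?G = 2 * r - 1"
    unfolding harmonious_achromatic_number_def
  proof (rule cSup_eq_maximum)
    show "2 * r - 1 \<in> {card (pverts H) |H. harmonious_image ?G H}"
      using star_clique_merge_centre[OF r] by (force simp: harmonious_image_def)
    show "n \<le> 2 * r - 1" if "n \<in> {card (pverts H) |H. harmonious_image ?G H}" for n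
      using that image(1) r by (force simp: harmonious_image_def)
  qed
  then show ?thesis
    using image harmonious_chromatic_number_star_clique[OF r] pair_graph_axioms
    by (intro exI[of _ ?G]) auto
qed

end
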